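(* For $n\ge 0$ let $f(n)=|S_n(3\textrm{-}\bar{1}\textrm{-}42,\ 3\textrm{-}\bar{1}\textrm{-}24)|$, with $f(0)=1$. Let $F_n$ denote the $n$th Fibonacci number with $F_0=F_1=1$ and $F_n=F_{n-1}+F_{n-2}$ for $n\ge 2$. For integers $n,k\ge 0$ define the convolved Fibonacci numbers $$a(n,k)=\sum_{\substack{n_1,\dots,n_{k+1}\ge 0\\ n_1+\cdots+n_{k+1}=n-k-2}} F_{n_1}F_{n_2}\cdots F_{n_{k+1}}\quad\text{for } n\ge k+2,$$ and $a(n,k)=0$ otherwise. Let $X=(f(0),f(1),f(2),f(3),\dots)^{T}$, let $F=(1,F_0,F_1,F_2,F_3,\dots)^{T}$ (infinite column vectors), and let $\mathbf{A}=(a(n,k))_{n,k\ge 0}$, an infinite lower triangular matrix. Then $$X=(\mathbf{I}-\mathbf{A})^{-1}F,$$ where $\mathbf{I}$ is the infinite identity matrix.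
   Context: $\mathfrak{S}_n$ is the set of permutations of $\{1,\dots,n\}$ written in one-line notation $\sigma=\sigma_1\sigma_2\cdots\sigma_n$. Barred (generalized) patterns: in a generalized pattern, letters not separated by a dash must be matched by entries in adjacent positions of $\sigma$, while letters separated by a dash need not be adjacent. A permutation $\sigma$ avoids a barred pattern if every occurrence in $\sigma$ of the pattern formed by the unbarred letters is part of an occurrence of the full pattern (with the bar removed). Explicitly: (i) $\sigma$ avoids $3\textrm{-}\bar{1}\textrm{-}42$ if for all positions $i<j<j+1\le n$ with $\sigma_{j+1}<\sigma_i<\sigma_j$ there is $p$ with $i<p<j$ and $\sigma_p<\sigma_{j+1}$; (ii) $\sigma$ avoids $3\textrm{-}\bar{1}\textrm{-}24$ if for all positions $i<j<j+1\le n$ with $\sigma_{j}<\sigma_i<\sigma_{j+1}$ there is $p$ with $i<p<j$ and $\sigma_p<\sigma_{j}$. $S_n(3\textrm{-}\bar{1}\textrm{-}42,\ 3\textrm{-}\bar{1}\textrm{-}24)$ is the set of $\sigma\in\mathfrak{S}_n$ avoiding both patterns. Rows and columns of the infinite matrices and vectors are indexed by $0,1,2,\dots$; the inverse $(\mathbf{I}-\mathbf{A})^{-1}$ is the inverse among infinite lower triangular matrices (which exists since $\mathbf{A}$ is strictly lower triangular). *)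

theory Defs
  imports "HOL-Combinatorics.Permutations" "HOL-Number_Theory.Fib"
begin

text \<open>
  A permutation of \<open>{1..n}\<close> is a function \<open>s\<close> with \<open>s permutes {1..n}\<close>; its one-line
  notation is \<open>s 1, \<dots>, s n\<close>.

  Avoidance of the barred patterns 3-(1)-42 and 3-(1)-24, the bar being written as parentheses:
  every occurrence of the unbarred part, whose last two letters are adjacent in \<open>s\<close>, extends
  to an occurrence of the full pattern.
\<close>

definition avoids_3_bar1_42 :: "nat \<Rightarrow> (nat \<Rightarrow> nat) \<Rightarrow> bool" where
  "avoids_3_bar1_42 n s \<longleftrightarrow>
     (\<forall>i j. 1 \<le> i \<and> i < j \<and> j + 1 \<le> n \<and> s (j + 1) < s i \<and> s i < s j
        \<longrightarrow> (\<exists>p. i < p \<and> p < j \<and> s p < s (j + 1)))"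

definition avoids_3_bar1_24 :: "nat \<Rightarrow> (nat \<Rightarrow> nat) \<Rightarrow> bool" where
  "avoids_3_bar1_24 n s \<longleftrightarrow>
     (\<forall>i j. 1 \<le> i \<and> i < j \<and> j + 1 \<le> n \<and> s j < s i \<and> s i < s (j + 1)
        \<longrightarrow> (\<exists>p. i < p \<and> p < j \<and> s p < s j))"

definition avoiders :: "nat \<Rightarrow> (nat \<Rightarrow> nat) set" where
  "avoiders n = {s. s permutes {1..n} \<and> avoids_3_bar1_42 n s \<and> avoids_3_bar1_24 n s}"

definition num_avoiders :: "nat \<Rightarrow> nat" where
  "num_avoiders n = card (avoiders n)"

lemma num_avoiders_0: "num_avoiders 0 = 1"
  by (simp add: num_avoiders_def avoiders_def avoids_3_bar1_42_def avoids_3_bar1_24_def)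

text \<open>The library function \<open>fib\<close> starts with \<open>0, 1\<close>, whereas here \<open>fibF 0 = fibF 1 = 1\<close>.\<close>

definition fibF :: "nat \<Rightarrow> nat" where
  "fibF n = fib (n + 1)"

lemma fibF_rec: "fibF 0 = 1" "fibF 1 = 1" "n \<ge> 2 \<Longrightarrow> fibF n = fibF (n - 1) + fibF (n - 2)"
proof -
  show "fibF 0 = 1" "fibF 1 = 1" by (simp_all add: fibF_def)
  assume "n \<ge> 2"
  then obtain m where "n = m + 2" by (metis add.commute le_Suc_ex)
  then show "fibF n = fibF (n - 1) + fibF (n - 2)" by (simp add: fibF_def)
qed

text \<open>Tuples \<open>(n\<^sub>1, \<dots>, n\<^sub>k\<^sub>+\<^sub>1)\<close> of natural numbers are lists of length \<open>k + 1\<close>.\<close>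

definition conv_fib :: "nat \<Rightarrow> nat \<Rightarrow> nat" where
  "conv_fib n k = (if n \<ge> k + 2
     then \<Sum>ns | length ns = k + 1 \<and> sum_list ns = n - k - 2. prod_list (map fibF ns)
     else 0)"

lemma finite_tuples: "finite {ns :: nat list. length ns = l \<and> sum_list ns = m}"
proof (rule finite_subset)
  show "{ns :: nat list. length ns = l \<and> sum_list ns = m} \<subseteq>
      {ns. set ns \<subseteq> {..m} \<and> length ns = l}"
    using member_le_sum_list by fastforce
  show "finite {ns :: nat list. set ns \<subseteq> {..m} \<and> length ns = l}"
    by (rule finite_lists_length_eq) simp
qed

text \<open>
  Infinite matrices and column vectors, with rows and columns indexed by \<open>0, 1, 2, \<dots>\<close>. The two
  products below are only used for a lower triangular left factor, whose row \<open>n\<close> vanishes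
  beyond column \<open>n\<close>; this is why the sums may stop at \<open>n\<close>.
\<close>

type_synonym inf_mat = "nat \<Rightarrow> nat \<Rightarrow> int"
type_synonym inf_vec = "nat \<Rightarrow> int"

definition lower_triangular :: "inf_mat \<Rightarrow> bool" where
  "lower_triangular M \<longleftrightarrow> (\<forall>n k. n < k \<longrightarrow> M n k = 0)"

definition lt_mult :: "inf_mat \<Rightarrow> inf_mat \<Rightarrow> inf_mat" where
  "lt_mult M N = (\<lambda>n k. \<Sum>j\<le>n. M n j * N j k)"

definition lt_apply :: "inf_mat \<Rightarrow> inf_vec \<Rightarrow> inf_vec" where
  "lt_apply M v = (\<lambda>n. \<Sum>j\<le>n. M n j * v j)"

definition id_mat :: inf_mat where
  "id_mat = (\<lambda>n k. if n = k then 1 else 0)"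

definition is_lt_inverse :: "inf_mat \<Rightarrow> inf_mat \<Rightarrow> bool" where
  "is_lt_inverse M B \<longleftrightarrow>
     lower_triangular B \<and> lt_mult M B = id_mat \<and> lt_mult B M = id_mat"

definition lt_inverse :: "inf_mat \<Rightarrow> inf_mat" where
  "lt_inverse M = (THE B. is_lt_inverse M B)"

definition A_mat :: inf_mat where
  "A_mat = (\<lambda>n k. int (conv_fib n k))"

definition F_vec :: inf_vec where
  "F_vec = (\<lambda>n. case n of 0 \<Rightarrow> 1 | Suc m \<Rightarrow> int (fibF m))"

definition X_vec :: inf_vec where
  "X_vec = (\<lambda>n. int (num_avoiders n))"

text \<open>
  The description in \<open>lt_inverse\<close> is proper for \<open>id_mat - A_mat\<close>: there is exactly one
  inverse (the subtraction is the pointwise one on functions).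
\<close>

lemma lt_mult_assoc:
  assumes "lower_triangular N"
  shows "lt_mult (lt_mult M N) P = lt_mult M (lt_mult N P)"
proof (intro ext)
  fix n k
  have "lt_mult (lt_mult M N) P n k = (\<Sum>l\<le>n. \<Sum>j\<le>n. M n j * N j l * P l k)"
    by (simp add: lt_mult_def sum_distrib_right)
  also have "\<dots> = (\<Sum>j\<le>n. \<Sum>l\<le>n. M n j * (N j l * P l k))"
    by (subst sum.swap) (simp add: mult.assoc)
  also have "\<dots> = (\<Sum>j\<le>n. \<Sum>l\<le>j. M n j * (N j l * P l k))"
    by (intro sum.cong refl sum.mono_neutral_right)
      (use assms in \<open>auto simp: lower_triangular_def\<close>)
  also have "\<dots> = lt_mult M (lt_mult N P) n k"
    by (simp add: lt_mult_def sum_distrib_left)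
  finally show "lt_mult (lt_mult M N) P n k = lt_mult M (lt_mult N P) n k" .
qed

lemma lt_mult_id_left: "lt_mult id_mat M = M"
  by (intro ext) (simp add: lt_mult_def id_mat_def if_distrib [of "\<lambda>x. x * _"] cong: if_cong)

lemma lt_mult_id_right: "lower_triangular M \<Longrightarrow> lt_mult M id_mat = M"
  by (intro ext) (auto simp: lt_mult_def id_mat_def lower_triangular_def
      if_distrib [of "\<lambda>x. _ * x"] cong: if_cong)

lemma lower_triangular_id_minus_A: "lower_triangular (id_mat - A_mat)"
  by (auto simp: lower_triangular_def id_mat_def A_mat_def conv_fib_def)

lemma A_mat_strict: "n \<le> k \<Longrightarrow> A_mat n k = 0"
  by (simp add: A_mat_def conv_fib_def)

function right_inv :: "nat \<Rightarrow> nat \<Rightarrow> int" where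
  "right_inv n k = id_mat n k + (\<Sum>j\<in>{..<n}. A_mat n j * right_inv j k)"
  by auto
termination by (relation "measure fst") auto

function left_inv :: "nat \<Rightarrow> nat \<Rightarrow> int" where
  "left_inv n k = id_mat n k + (\<Sum>j\<in>{k<..n}. left_inv n j * A_mat j k)"
  by auto
termination by (relation "measure (\<lambda>(n, k). n - k)") auto

declare right_inv.simps [simp del] left_inv.simps [simp del]

lemma lower_triangular_right_inv: "lower_triangular right_inv"
proof -
  have "n < k \<longrightarrow> right_inv n k = 0" for n k
  proof (induction n rule: less_induct)
    case (less n)
    then show ?case by (subst right_inv.simps) (auto simp: id_mat_def intro!: sum.neutral)
  qed
  then show ?thesis by (simp add: lower_triangular_def)
qed

lemma lower_triangular_left_inv: "lower_triangular left_inv"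
proof -
  have "left_inv n k = 0" if "n < k" for n k
    using that by (subst left_inv.simps) (simp add: id_mat_def)
  then show ?thesis by (simp add: lower_triangular_def)
qed

lemma lt_mult_right_inv: "lt_mult (id_mat - A_mat) right_inv = id_mat"
proof (intro ext)
  fix n k
  have "lt_mult (id_mat - A_mat) right_inv n k =
      lt_mult id_mat right_inv n k - (\<Sum>j\<le>n. A_mat n j * right_inv j k)"
    by (simp add: lt_mult_def left_diff_distrib sum_subtractf)
  also have "(\<Sum>j\<le>n. A_mat n j * right_inv j k) = (\<Sum>j\<in>{..<n}. A_mat n j * right_inv j k)"
    by (intro sum.mono_neutral_right) (auto simp: A_mat_strict)
  also have "lt_mult id_mat right_inv n k - \<dots> = id_mat n k"
    unfolding lt_mult_id_left by (subst right_inv.simps) simp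
  finally show "lt_mult (id_mat - A_mat) right_inv n k = id_mat n k" .
qed

lemma lt_mult_left_inv: "lt_mult left_inv (id_mat - A_mat) = id_mat"
proof (intro ext)
  fix n k
  have "lt_mult left_inv (id_mat - A_mat) n k =
      lt_mult left_inv id_mat n k - (\<Sum>j\<le>n. left_inv n j * A_mat j k)"
    by (simp add: lt_mult_def right_diff_distrib sum_subtractf)
  also have "(\<Sum>j\<le>n. left_inv n j * A_mat j k) = (\<Sum>j\<in>{k<..n}. left_inv n j * A_mat j k)"
    by (intro sum.mono_neutral_right) (auto simp: A_mat_strict not_less)
  also have "lt_mult left_inv id_mat n k - \<dots> = id_mat n k"
    unfolding lt_mult_id_right [OF lower_triangular_left_inv] by (subst left_inv.simps) simp
  finally show "lt_mult left_inv (id_mat - A_mat) n k = id_mat n k" .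
qed

lemma is_lt_inverse_unique:
  assumes "lower_triangular M" "is_lt_inverse M B" "is_lt_inverse M C"
  shows "B = C"
  using assms lt_mult_assoc [of M B C] lt_mult_id_left [of C] lt_mult_id_right [of B]
  by (simp add: is_lt_inverse_def)

lemma ex1_lt_inverse: "\<exists>!B. is_lt_inverse (id_mat - A_mat) B"
proof -
  have "left_inv = right_inv"
    using lt_mult_assoc [OF lower_triangular_id_minus_A, of left_inv right_inv]
    by (simp add: lt_mult_left_inv lt_mult_right_inv lt_mult_id_left
        lt_mult_id_right lower_triangular_left_inv)
  then have "is_lt_inverse (id_mat - A_mat) right_inv"
    using lower_triangular_right_inv lt_mult_right_inv lt_mult_left_inv
    by (simp add: is_lt_inverse_def)
  then show ?thesis
    using is_lt_inverse_unique [OF lower_triangular_id_minus_A] by blast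
qed

lemma is_lt_inverse_lt_inverse: "is_lt_inverse (id_mat - A_mat) (lt_inverse (id_mat - A_mat))"
  unfolding lt_inverse_def by (rule theI' [OF ex1_lt_inverse])

end

theory Submission
  imports Defs "HOL-Combinatorics.Multiset_Permutations"
begin

text \<open>
  Multiplying by \<open>I - A\<close> turns the claim into the recurrence
  \<open>f (n + 1) = F\<^sub>n + (\<Sum>k<n. a (n + 1, k) * f k)\<close> for the number \<open>f n\<close> of avoiders,
  proved as \<open>lw_count_recurrence\<close> below.

  Together the two patterns say: whenever a letter \<open>x\<close> lies in value strictly between two adjacent
  letters further to the right, some letter between them and \<open>x\<close> is smaller than both. Cut a word
  at its minimum, \<open>w = l a r\<close>. The letter \<open>a\<close> serves every pair inside \<open>r\<close> as seen from \<open>l\<close>, but it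
  serves neither the pairs inside \<open>l a\<close> nor the pair formed by \<open>a\<close> and the head of \<open>r\<close>. Hence \<open>w\<close>
  is an avoider iff \<open>r\<close> is one, \<open>l\<close> is descending, and the head of \<open>r\<close> is smaller than the last
  letter of \<open>l\<close> (\<open>avoiding_split_min_iff\<close>).

  This suggests counting, for each \<open>t\<close>, the pairs \<open>(y, z)\<close> in which \<open>y\<close> is descending of length
  \<open>t\<close>, continues to descend into the head of \<open>z\<close>, and \<open>z\<close> is an avoider. Deleting the minimum of
  \<open>z = l a r\<close> and moving \<open>l\<close> over to \<open>y\<close> gives the pair \<open>(y l, r)\<close> on one letter fewer, which is again
  of this kind if \<open>l\<close> is nonempty, whereas \<open>y\<close> and \<open>r\<close> are unrelated if \<open>l\<close> is empty
  (\<open>card_linked_words_insert_min\<close>). With \<open>p n t\<close> the number of pairs on \<open>n\<close> letters,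
  \<open>f n = p n 0\<close>, and the tail sums \<open>d n t = (\<Sum>s\<ge>t. p n s)\<close> satisfy \<open>d n n = 1\<close>,
  \<open>f (n + 1) = d n 0\<close> and
  \<open>d (n + 1) t = (n choose t) * f (n - t) + d n (t + 1) + d (n + 1) (t + 1)\<close>.

  The two recursive terms lower \<open>n - t\<close> by \<open>2\<close> and by \<open>1\<close>; this is where the Fibonacci numbers come
  from. Unrolling the recursion, the initial values \<open>d n n = 1\<close> contribute \<open>F\<^sub>n\<close> to \<open>d n 0\<close>, and
  \<open>f k\<close> gets as coefficient that of \<open>x ^ (n - 1 - k)\<close> in
  \<open>\<Sum>s. (k + s choose k) * (x + x\<^sup>2) ^ s = (1 - x - x\<^sup>2) ^ (- (k + 1))\<close>, which is the convolution of
  \<open>k + 1\<close> Fibonacci sequences.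
\<close>

section \<open>Avoiding words and their minimum\<close>

text \<open>
  The two barred patterns differ only in the order of the adjacent pair, so \<open>min\<close> and \<open>max\<close>
  express both at once. Decomposing the word instead of indexing it makes cutting easy.
\<close>

definition avoiding :: "'a :: linorder list \<Rightarrow> bool" where
  "avoiding xs \<longleftrightarrow> (\<forall>us x vs u v zs. xs = us @ x # vs @ u # v # zs \<longrightarrow> min u v < x \<longrightarrow> x < max u v \<longrightarrow>
     (\<exists>p\<in>set vs. p < min u v))"

lemma avoidingD:
  assumes "avoiding (us @ x # vs @ u # v # zs)" "min u v < x" "x < max u v"
  shows "\<exists>p\<in>set vs. p < min u v"
  using assms unfolding avoiding_def by blast

lemma avoiding_prefix: "avoiding (xs @ ys) \<Longrightarrow> avoiding xs"
  unfolding avoiding_def by (metis append.assoc append_Cons)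

lemma avoiding_suffix: "avoiding (xs @ ys) \<Longrightarrow> avoiding ys"
  unfolding avoiding_def by (metis append.assoc)

lemma avoiding_Nil [simp]: "avoiding []"
  by (simp add: avoiding_def)

text \<open>
  A letter of \<open>l\<close> below the last letter \<open>b\<close> of \<open>l\<close> would lie between \<open>b\<close> and \<open>a\<close>, and no letter is
  smaller than \<open>a\<close>. So \<open>b\<close> is the minimum of \<open>l\<close>, and the argument repeats with \<open>b\<close> in place of \<open>a\<close>.
\<close>

lemma avoiding_descending_to_min:
  assumes "avoiding (l @ [a])" "distinct l" "\<forall>x\<in>set l. a < x"
  shows "sorted_wrt (>) l"
  using assms
proof (induction l arbitrary: a rule: rev_induct)
  case (snoc b l)
  have "b < x" if x: "x \<in> set l" for x
  proof (rule ccontr)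
    assume "\<not> b < x"
    with x snoc.prems have "x < b" by (metis distinct_append distinct_singleton
          disjoint_iff list.set_intros(1) linorder_neqE)
    from x obtain us vs where l: "l = us @ x # vs" by (meson split_list)
    have "\<exists>p\<in>set vs. p < min b a"
      by (rule avoidingD [of us x vs b a "[]"])
        (use snoc.prems l \<open>x < b\<close> in \<open>auto simp: min_less_iff_disj less_max_iff_disj\<close>)
    with snoc.prems l show False by (auto dest: less_asym)
  qed
  moreover have "sorted_wrt (>) l"
    using snoc.IH [of b] avoiding_prefix [of "l @ [b]" "[a]"] snoc.prems calculation by simp
  ultimately show ?case by (simp add: sorted_wrt_append)
qed simp

text \<open>
  The use of \<open>take 1 r\<close> covers an empty \<open>r\<close>, and an empty \<open>l\<close>, for which the head of \<open>r\<close> is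
  unrestricted. For the converse, the position of \<open>a\<close> in an occurrence decides: \<open>a\<close> before the
  occurrence leaves it inside \<open>r\<close>; between \<open>x\<close> and the adjacent pair, \<open>a\<close> is the required small
  letter; every other position contradicts that \<open>l @ take 1 r\<close> descends or that \<open>a\<close> is minimal.
\<close>

lemma avoiding_split_min_iff:
  assumes "distinct (l @ a # r)" "\<forall>x\<in>set l \<union> set r. a < x"
  shows "avoiding (l @ a # r) \<longleftrightarrow> sorted_wrt (>) (l @ take 1 r) \<and> avoiding r"
proof
  assume g: "avoiding (l @ a # r)"
  have "avoiding r" using avoiding_suffix [of "l @ [a]" r] g by simp
  moreover have l: "sorted_wrt (>) l"
    using avoiding_descending_to_min [of l a] avoiding_prefix [of "l @ [a]" r] g assms by simp
  moreover have "c < x" if r: "r = c # r'" and x: "x \<in> set l" for c r' x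
  proof (rule ccontr)
    assume "\<not> c < x"
    obtain l' b where lb: "l = l' @ [b]" using x by (metis empty_iff list.set(1) rev_exhaust)
    have "b \<le> x" using l x lb by (auto simp: sorted_wrt_append)
    then have "b < c" using \<open>\<not> c < x\<close> assms r lb by force
    have "a < b" using assms lb by simp
    have "\<exists>p\<in>set []. p < min a c"
      by (rule avoidingD [of l' b "[]" a c r']) (use g lb r \<open>b < c\<close> \<open>a < b\<close> in auto)
    then show False by simp
  qed
  ultimately show "sorted_wrt (>) (l @ take 1 r) \<and> avoiding r"
    by (cases r) (auto simp: sorted_wrt_append)
next
  assume rhs: "sorted_wrt (>) (l @ take 1 r) \<and> avoiding r"
  then have l: "sorted_wrt (>) l" and gr: "avoiding r"
    and lr: "\<And>c r' x. r = c # r' \<Longrightarrow> x \<in> set l \<Longrightarrow> c < x"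
    by (auto simp: sorted_wrt_append)
  have uniq: "l = l' \<and> r = r'" if "l @ a # r = l' @ a # r'" for l' r'
    using that assms(1) by (metis append_Cons_eq_iff distinct.simps(2) distinct_append
        disjoint_iff list.set_intros(1))
  have a_min: "\<forall>y\<in>set (l @ a # r). a \<le> y" using assms(2) by (auto simp: less_imp_le)
  show "avoiding (l @ a # r)"
    unfolding avoiding_def
  proof (intro allI impI)
    fix us x vs u v zs
    assume eq: "l @ a # r = us @ x # vs @ u # v # zs" and x: "min u v < x" "x < max u v"
    have au: "a \<le> u" "a \<le> v" using a_min unfolding eq by auto
    have "a \<in> set (us @ x # vs @ u # v # zs)" by (metis eq in_set_conv_decomp)
    then consider "a \<in> set us" | "a = x" | "a \<in> set vs" | "a = u" | "a = v" | "a \<in> set zs"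
      by auto
    then show "\<exists>p\<in>set vs. p < min u v"
    proof cases
      case 1
      then obtain b c where "us = b @ a # c" by (meson split_list)
      with eq uniq [of b "c @ x # vs @ u # v # zs"] have "r = c @ x # vs @ u # v # zs" by simp
      with gr x show ?thesis using avoidingD by metis
    next
      case 2
      with x au show ?thesis by (auto simp: min_less_iff_disj)
    next
      case 3
      then have "a \<noteq> u" "a \<noteq> v" using assms(1) unfolding eq by auto
      with 3 au show ?thesis by (intro bexI [of _ a]) auto
    next
      case 4
      with eq uniq [of "us @ x # vs" "v # zs"] have "l = us @ x # vs" "r = v # zs" by auto
      with lr [of v zs x] 4 x au show ?thesis by auto
    next
      case 5
      with eq uniq [of "us @ x # vs @ [u]" zs] have "l = us @ x # vs @ [u]" by auto
      with l 5 x au show ?thesis by (auto simp: sorted_wrt_append)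
    next
      case 6
      then obtain b c where "zs = b @ a # c" by (meson split_list)
      with eq uniq [of "us @ x # vs @ u # v # b" c] have "l = us @ x # vs @ u # v # b" by auto
      with l x show ?thesis by (auto simp: sorted_wrt_append)
    qed
  qed
qed

section \<open>Counting words with a descending prefix\<close>

text \<open>
  Words cut after \<open>t\<close> letters, with descending first part and avoiding second part. In a linked word
  the descent moreover continues across the cut.
\<close>

definition split_words :: "'a :: linorder set \<Rightarrow> nat \<Rightarrow> ('a list \<times> 'a list) set" where
  "split_words A t = {(y, z). y @ z \<in> permutations_of_set A \<and> length y = t \<and>
     sorted_wrt (>) y \<and> avoiding z}"

definition linked_words :: "'a :: linorder set \<Rightarrow> nat \<Rightarrow> ('a list \<times> 'a list) set" where
  "linked_words A t = {(y, z) \<in> split_words A t. sorted_wrt (>) (y @ take 1 z)}"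

lemma finite_split_words [simp]: "finite (split_words A t)"
proof (cases "finite A")
  case True
  have "split_words A t \<subseteq> (\<lambda>x. (take t x, drop t x)) ` permutations_of_set A"
  proof (rule subsetI)
    fix p assume "p \<in> split_words A t"
    then obtain y z where p: "p = (y, z)" "y @ z \<in> permutations_of_set A" "length y = t"
      by (auto simp: split_words_def)
    then have "p = (take t (y @ z), drop t (y @ z))" by simp
    with p(2) show "p \<in> (\<lambda>x. (take t x, drop t x)) ` permutations_of_set A"
      by (rule image_eqI [rotated])
  qed
  then show ?thesis by (rule finite_subset) simp
next
  case False
  then have "split_words A t = {}"
    by (auto simp: split_words_def permutations_of_set_def)
  then show ?thesis by simp
qed

lemma finite_linked_words [simp]: "finite (linked_words A t)"
  by (rule finite_subset [OF _ finite_split_words [of A t]]) (auto simp: linked_words_def)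

lemma linked_words_0: "linked_words A 0 = {[]} \<times> {z \<in> permutations_of_set A. avoiding z}"
proof -
  have "sorted_wrt (>) (take 1 z)" for z :: "'a list"
    by (cases z) auto
  then show ?thesis by (auto simp: linked_words_def split_words_def)
qed

lemma linked_words_empty:
  assumes "finite A" "card A < t"
  shows "linked_words A t = {}"
  using assms length_finite_permutations_of_set
  by (fastforce simp: linked_words_def split_words_def)

lemma sorted_desc_unique:
  fixes xs ys :: "'a :: linorder list"
  assumes "sorted_wrt (>) xs" "sorted_wrt (>) ys" "set xs = set ys"
  shows "xs = ys"
proof -
  have "rev xs = rev ys"
    by (rule strict_sorted_equal) (use assms in \<open>auto simp: sorted_wrt_rev\<close>)
  then show ?thesis by simp
qed

lemma descending_list_exists:
  fixes T :: "'a :: linorder set"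
  assumes "finite T"
  shows "\<exists>y. sorted_wrt (>) y \<and> set y = T \<and> length y = card T \<and> distinct y"
  by (rule exI [of _ "rev (sorted_list_of_set T)"])
    (use assms in \<open>auto simp: sorted_wrt_rev\<close>)

lemma card_linked_words_full:
  assumes "finite A"
  shows "card (linked_words A (card A)) = 1"
proof -
  obtain y where y: "sorted_wrt (>) y" "set y = A" "length y = card A" "distinct y"
    using descending_list_exists [OF assms] by blast
  have "linked_words A (card A) = {(y, [])}"
  proof (intro set_eqI iffI)
    fix p assume p: "p \<in> linked_words A (card A)"
    obtain y' z where p': "p = (y', z)" by force
    have "length (y' @ z) = card A" "length y' = card A"
      using p assms length_finite_permutations_of_set
      by (auto simp: p' linked_words_def split_words_def simp del: length_append)
    then have "z = []" by simp
    moreover from this have "y' = y"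
      by (intro sorted_desc_unique)
        (use p y in \<open>auto simp: p' linked_words_def split_words_def permutations_of_set_def\<close>)
    ultimately show "p \<in> {(y, [])}" by (simp add: p')
  qed (use y in \<open>auto simp: linked_words_def split_words_def permutations_of_set_def\<close>)
  then show ?thesis by simp
qed

text \<open>
  A descending list is determined by its set of letters, so \<open>y\<close> is an arbitrary \<open>t\<close>-subset and \<open>z\<close>
  an arbitrary avoiding word on the remaining letters.
\<close>

lemma card_split_words:
  fixes A :: "'a :: linorder set"
  assumes "finite A"
    and "\<And>T. T \<subseteq> A \<Longrightarrow> card T = t \<Longrightarrow> card (linked_words (A - T) 0) = m"
  shows "card (split_words A t) = (card A choose t) * m"
proof -
  let ?\<T> = "{T. T \<subseteq> A \<and> card T = t}"
  let ?W = "\<lambda>T. {z \<in> permutations_of_set (A - T). avoiding z}"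
  let ?h = "\<lambda>(y :: 'a list, z :: 'a list). (set y, z)"
  have fin: "finite T" if "T \<in> ?\<T>" for T
    using that assms(1) finite_subset by blast
  have "bij_betw ?h (split_words A t) (Sigma ?\<T> ?W)"
  proof (rule bij_betw_imageI)
    show "inj_on ?h (split_words A t)"
      by (auto simp: inj_on_def split_words_def intro: sorted_desc_unique)
    show "?h ` split_words A t = Sigma ?\<T> ?W"
    proof (intro set_eqI iffI)
      fix p assume "p \<in> ?h ` split_words A t"
      then show "p \<in> Sigma ?\<T> ?W"
        by (auto simp: split_words_def permutations_of_set_def distinct_card)
    next
      fix p assume p: "p \<in> Sigma ?\<T> ?W"
      then obtain T z where p': "p = (T, z)" "T \<in> ?\<T>" "z \<in> ?W T" by blast
      obtain y where "sorted_wrt (>) y" "set y = T" "length y = card T" "distinct y"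
        using descending_list_exists [OF fin] p' by blast
      with p' have "(y, z) \<in> split_words A t"
        by (auto simp: split_words_def permutations_of_set_def)
      with p' \<open>set y = T\<close> show "p \<in> ?h ` split_words A t" by force
    qed
  qed
  then have "card (split_words A t) = card (Sigma ?\<T> ?W)"
    by (rule bij_betw_same_card)
  also have "\<dots> = (\<Sum>T\<in>?\<T>. card (?W T))"
    using assms(1) by (subst card_SigmaI) auto
  also have "\<dots> = (\<Sum>T\<in>?\<T>. m)"
    using assms(2) by (intro sum.cong) (auto simp: linked_words_0 card_cartesian_product)
  finally show ?thesis using n_subsets [OF assms(1)] by simp
qed

text \<open>
  Two descending words that share an end letter can be glued, by transitivity.
\<close>

lemma sorted_desc_overlap:
  fixes c :: "'a :: linorder"
  shows "sorted_wrt (>) (ys @ c # zs) \<longleftrightarrow> sorted_wrt (>) (ys @ [c]) \<and> sorted_wrt (>) (c # zs)"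
  by (auto simp: sorted_wrt_append intro: order.strict_trans)

text \<open>
  Since \<open>t\<close> is at most the size of \<open>A\<close>, the second part of a linked word \<open>(y, z)\<close> is nonempty, and
  linkedness forces the minimum \<open>a\<close> into it: \<open>z = l @ a # r\<close>. The word is sent to \<open>(y @ l, r)\<close>,
  and since \<open>t\<close> is known, \<open>y\<close> and \<open>l\<close> can be recovered. For \<open>l = []\<close> the images are all split words
  with first part of length \<open>t\<close>; for nonempty \<open>l\<close> they are the linked words with a longer first part.
\<close>

lemma card_linked_words_insert_min:
  fixes A :: "'a :: linorder set"
  assumes "finite A" "\<forall>x\<in>A. a < x" "t \<le> card A"
  shows "card (linked_words (insert a A) t) =
    card (split_words A t) + (\<Sum>s\<in>{t<..card A}. card (linked_words A s))"
proof -
  let ?U = "split_words A t \<union> (\<Union>s\<in>{t<..card A}. linked_words A s)"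
  let ?g = "\<lambda>(q :: 'a list, r). (take t q, drop t q @ a # r)"
  have "a \<notin> A" using assms by auto
  have length_fst: "p \<in> split_words A s \<Longrightarrow> length (fst p) = s"
    "p \<in> linked_words A s \<Longrightarrow> length (fst p) = s" for p s
    by (auto simp: split_words_def linked_words_def)
  \<comment> \<open>One equivalence serves both inclusions of the image of \<open>?g\<close>.\<close>
  have step: "?g (q, r) \<in> linked_words (insert a A) t \<and> t \<le> length q \<longleftrightarrow> (q, r) \<in> ?U" for q r
  proof (cases "q @ r \<in> permutations_of_set A \<and> t \<le> length q")
    case True
    then have gt: "\<forall>x\<in>set q \<union> set r. a < x"
      using assms by (auto simp: permutations_of_set_def)
    have q: "q = take t q @ drop t q" by simp
    have gtd: "\<forall>x\<in>set (drop t q) \<union> set r. a < x" "\<forall>x\<in>set (take t q). a < x"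
      using gt by (auto dest: in_set_takeD in_set_dropD)
    have dist: "distinct (drop t q @ a # r)"
      using True gtd by (subst (asm) q) (auto simp: permutations_of_set_def simp del: append_take_drop_id)
    have perm: "take t q @ drop t q @ a # r \<in> permutations_of_set (insert a A)"
      using True gt \<open>a \<notin> A\<close> unfolding append.assoc [symmetric] append_take_drop_id
      by (auto simp: permutations_of_set_def)
    have "?g (q, r) \<in> linked_words (insert a A) t \<longleftrightarrow>
       sorted_wrt (>) (take t q @ take 1 (drop t q @ a # r)) \<and>
       sorted_wrt (>) (drop t q @ take 1 r) \<and> avoiding r"
      using perm True avoiding_split_min_iff [OF dist gtd(1)]
      by (auto simp: linked_words_def split_words_def sorted_wrt_append)
    also have "\<dots> \<longleftrightarrow> (length q = t \<or> sorted_wrt (>) (q @ take 1 r)) \<and> sorted_wrt (>) q \<and> avoiding r"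
    proof (cases "length q = t")
      case False
      then obtain c d where cd: "drop t q = c # d"
        using True by (metis drop_eq_Nil le_antisym list.exhaust)
      have "sorted_wrt (>) (q @ take 1 r) \<longleftrightarrow> sorted_wrt (>) (take t q @ (c # d) @ take 1 r)"
        by (metis append.assoc append_take_drop_id cd)
      also have "\<dots> \<longleftrightarrow> sorted_wrt (>) (take t q @ [c]) \<and> sorted_wrt (>) ((c # d) @ take 1 r)"
        using sorted_desc_overlap [of "take t q" c "d @ take 1 r"] by simp
      finally have "sorted_wrt (>) (q @ take 1 r) \<longleftrightarrow>
          sorted_wrt (>) (take t q @ [c]) \<and> sorted_wrt (>) (drop t q @ take 1 r)"
        by (simp add: cd)
      moreover have "sorted_wrt (>) (q @ take 1 r) \<Longrightarrow> sorted_wrt (>) q"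
        by (simp add: sorted_wrt_append)
      ultimately show ?thesis using False cd by auto
    qed (use gtd True in \<open>cases r; auto simp: sorted_wrt_append\<close>)
    also have "\<dots> \<longleftrightarrow> (q, r) \<in> ?U"
    proof -
      have "length q \<le> card A"
        using True length_finite_permutations_of_set [of "q @ r" A] by simp
      then show ?thesis using True
        by (auto simp: linked_words_def split_words_def)
    qed
    finally show ?thesis using True by simp
  next
    case False
    have "(q, r) \<notin> ?U"
      using False by (auto simp: linked_words_def split_words_def)
    moreover have "q @ r \<in> permutations_of_set A"
      if "take t q @ drop t q @ a # r \<in> permutations_of_set (insert a A)"
      using that \<open>a \<notin> A\<close> unfolding append.assoc [symmetric] append_take_drop_id
      by (auto simp: permutations_of_set_def)
    moreover have "take t q @ drop t q @ a # r \<in> permutations_of_set (insert a A)"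
      if "?g (q, r) \<in> linked_words (insert a A) t"
      using that by (simp add: linked_words_def split_words_def)
    ultimately show ?thesis using False by blast
  qed
  have "bij_betw ?g ?U (linked_words (insert a A) t)"
  proof (rule bij_betw_imageI)
    show "inj_on ?g ?U"
    proof (rule inj_onI, clarify)
      fix q r q' r'
      assume U: "(q, r) \<in> ?U" "(q', r') \<in> ?U"
        and eq: "take t q = take t q'" "drop t q @ a # r = drop t q' @ a # r'"
      have "a \<notin> set q \<union> set r" "a \<notin> set q' \<union> set r'"
        using U \<open>a \<notin> A\<close> by (auto simp: linked_words_def split_words_def permutations_of_set_def)
      then have "a \<notin> set (drop t q)" "a \<notin> set r" by (auto dest: in_set_dropD)
      then have "drop t q = drop t q' \<and> r = r'"
        using eq(2) append_Cons_eq_iff by metis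
      with eq(1) show "q = q' \<and> r = r'" by (metis append_take_drop_id)
    qed
    show "?g ` ?U = linked_words (insert a A) t"
    proof (intro equalityI subsetI)
      fix p assume "p \<in> ?g ` ?U"
      then obtain u where u: "p = ?g u" "u \<in> ?U" by (rule imageE)
      obtain q r where "u = (q, r)" by force
      with u have "p = ?g (q, r)" "(q, r) \<in> ?U" by simp_all
      with step [of q r] show "p \<in> linked_words (insert a A) t" by simp
    next
      fix p assume p: "p \<in> linked_words (insert a A) t"
      obtain y z where yz: "p = (y, z)" by force
      have y: "length y = t" "set y \<union> set z = insert a A" "distinct (y @ z)"
        "length (y @ z) = Suc (card A)"
        using p assms(1) \<open>a \<notin> A\<close> length_finite_permutations_of_set [of "y @ z" "insert a A"]
        by (auto simp: yz linked_words_def split_words_def permutations_of_set_def)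
      have "a \<in> set z"
      proof (rule ccontr)
        assume "a \<notin> set z"
        then have "a \<in> set y" using y by auto
        obtain c z' where z: "z = c # z'" using y assms(3) by (cases z) auto
        then have "c \<in> A" using y \<open>a \<notin> set z\<close> by auto
        moreover have "c < a"
          using p \<open>a \<in> set y\<close> by (auto simp: yz z linked_words_def sorted_wrt_append)
        ultimately show False using assms(2) by auto
      qed
      then obtain l r where "z = l @ a # r" by (meson split_list)
      then have pg: "p = ?g (y @ l, r)" "t \<le> length (y @ l)" using y(1) by (auto simp: yz)
      have "?g (y @ l, r) \<in> linked_words (insert a A) t \<and> t \<le> length (y @ l)"
        using p pg(2) unfolding pg(1) by (rule conjI)
      then have "(y @ l, r) \<in> ?U" by (rule step [THEN iffD1])
      with pg(1) show "p \<in> ?g ` ?U" by (rule image_eqI)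
    qed
  qed
  then have "card (linked_words (insert a A) t) = card ?U"
    by (rule bij_betw_same_card [symmetric])
  also have "\<dots> = card (split_words A t) + card (\<Union>s\<in>{t<..card A}. linked_words A s)"
    by (rule card_Un_disjoint) (auto dest!: length_fst)
  also have "card (\<Union>s\<in>{t<..card A}. linked_words A s) = (\<Sum>s\<in>{t<..card A}. card (linked_words A s))"
    by (rule card_UN_disjoint) (auto dest!: length_fst)
  finally show ?thesis .
qed

text \<open>
  The number of linked words as a function of the number of letters alone. The binomial
  coefficient counts the subsets of \<open>card_split_words\<close>, and \<open>lw_count (n - 1 - t) 0\<close>
  counts avoiding words, which are the linked words with empty first part.
\<close>

function lw_count :: "nat \<Rightarrow> nat \<Rightarrow> nat" where
  "lw_count n t = (if n < t then 0 else if n = t then 1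
     else (n - 1 choose t) * lw_count (n - 1 - t) 0 + (\<Sum>s\<in>{t<..n - 1}. lw_count (n - 1) s))"
  by auto
termination by (relation "measure fst") auto

declare lw_count.simps [simp del]

lemma card_linked_words:
  fixes A :: "'a :: linorder set"
  assumes "finite A"
  shows "card (linked_words A t) = lw_count (card A) t"
  using assms
proof (induction "card A" arbitrary: A t rule: less_induct)
  case less
  consider "card A < t" | "card A = t" | "t < card A" by linarith
  then show ?case
  proof cases
    case 1
    then show ?thesis using less.prems by (simp add: linked_words_empty lw_count.simps)
  next
    case 2
    then show ?thesis using card_linked_words_full [OF less.prems]
      by (simp add: lw_count.simps)
  next
    case 3
    then have "A \<noteq> {}" by auto
    define a B where "a = Min A" and "B = A - {a}"
    have "a \<in> A" unfolding a_def using less.prems \<open>A \<noteq> {}\<close> by (rule Min_in)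
    then have A: "A = insert a B" "a \<in> A" by (auto simp: B_def)
    have B: "finite B" "card A = Suc (card B)"
      using less.prems A(2) card_Suc_Diff1 [of A a] by (simp_all add: B_def)
    have a_less: "\<forall>x\<in>B. a < x"
    proof
      fix x assume "x \<in> B"
      then have "x \<in> A" "x \<noteq> a" by (auto simp: B_def)
      with less.prems show "a < x" by (simp add: a_def less_le)
    qed
    have "card (linked_words A t) = card (split_words B t) +
        (\<Sum>s\<in>{t<..card B}. card (linked_words B s))"
      unfolding A(1) by (rule card_linked_words_insert_min) (use B a_less 3 in auto)
    also have "card (split_words B t) = (card B choose t) * lw_count (card B - t) 0"
    proof (rule card_split_words [OF B(1)])
      fix T assume T: "T \<subseteq> B" "card T = t"
      then have "card (B - T) = card B - t"
        using B(1) card_Diff_subset finite_subset by metis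
      then show "card (linked_words (B - T) 0) = lw_count (card B - t) 0"
        using less.hyps [of "B - T" 0] B by simp
    qed
    also have "(\<Sum>s\<in>{t<..card B}. card (linked_words B s)) = (\<Sum>s\<in>{t<..card B}. lw_count (card B) s)"
      using less.hyps [of B] B by simp
    finally show ?thesis using 3 B(2) by (subst lw_count.simps) simp
  qed
qed

section \<open>Solving the recursion\<close>

text \<open>
  Passing to tail sums replaces the unbounded sum in the recursion of \<open>lw_count\<close> by two terms.
\<close>

definition lw_tail :: "nat \<Rightarrow> nat \<Rightarrow> nat" where
  "lw_tail n t = (\<Sum>s\<in>{t..n}. lw_count n s)"

lemma lw_tail_diag: "lw_tail n n = 1"
  by (simp add: lw_tail_def lw_count.simps)

lemma lw_count_Suc:
  "t \<le> n \<Longrightarrow> lw_count (Suc n) t = (n choose t) * lw_count (n - t) 0 + lw_tail n (Suc t)"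
  by (subst lw_count.simps) (simp add: lw_tail_def atLeastSucAtMost_greaterThanAtMost)

lemma lw_tail_step: "t \<le> n \<Longrightarrow> lw_tail n t = lw_count n t + lw_tail n (Suc t)"
  by (simp add: lw_tail_def sum.atLeast_Suc_atMost)

lemma lw_tail_Suc:
  "t \<le> n \<Longrightarrow> lw_tail (Suc n) t =
     (n choose t) * lw_count (n - t) 0 + lw_tail n (Suc t) + lw_tail (Suc n) (Suc t)"
  using lw_tail_step [of t "Suc n"] lw_count_Suc [of t n] by simp

text \<open>
  For \<open>t = 0\<close> the binomial term is \<open>lw_count n 0\<close>, exactly the summand that completes the tail
  from \<open>1\<close> to the tail from \<open>0\<close>.
\<close>

lemma lw_count_Suc_0: "lw_count (Suc n) 0 = lw_tail n 0"
  using lw_count_Suc [of 0 n] lw_tail_step [of 0 n] by simp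

text \<open>
  The coefficient of \<open>x ^ m\<close> in \<open>\<Sum>s. (k + t + s choose k) * (x + x\<^sup>2) ^ s\<close>. Splitting off the term
  for \<open>s = 0\<close> and one factor \<open>x + x\<^sup>2\<close> from the others gives these equations.
\<close>

fun chain_weight :: "nat \<Rightarrow> nat \<Rightarrow> nat \<Rightarrow> nat" where
  "chain_weight k t 0 = (k + t choose k)"
| "chain_weight k t (Suc 0) = chain_weight k (Suc t) 0"
| "chain_weight k t (Suc (Suc m)) = chain_weight k (Suc t) (Suc m) + chain_weight k (Suc t) m"

lemma fibF_Suc_Suc: "fibF (Suc (Suc n)) = fibF (Suc n) + fibF n"
  by (simp add: fibF_def)

lemma fibF_0_1 [simp]: "fibF 0 = 1" "fibF (Suc 0) = 1"
  by (simp_all add: fibF_def)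

text \<open>
  Both sides obey the same recursion in \<open>w\<close>. In the step, the binomial term of \<open>lw_tail_Suc\<close> is the
  new summand for \<open>k = w + 1\<close>.
\<close>

lemma lw_tail_eq:
  "lw_tail (t + w) t = fibF w + (\<Sum>k<w. chain_weight k t (w - 1 - k) * lw_count k 0)"
proof (induction w arbitrary: t rule: fib.induct)
  case 1
  then show ?case by (simp add: lw_tail_diag)
next
  case 2
  have "lw_tail t (Suc t) = 0" by (simp add: lw_tail_def)
  then show ?case by (simp add: lw_tail_Suc lw_tail_diag)
next
  case (3 w)
  have "(\<Sum>k<w. chain_weight k t (w + 1 - k) * lw_count k 0) =
      (\<Sum>k<w. chain_weight k (Suc t) (w - k) * lw_count k 0) +
      (\<Sum>k<w. chain_weight k (Suc t) (w - 1 - k) * lw_count k 0)"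
    unfolding sum.distrib [symmetric]
  proof (rule sum.cong)
    fix k assume "k \<in> {..<w}"
    then have "w + 1 - k = Suc (Suc (w - 1 - k))" "w - k = Suc (w - 1 - k)" by auto
    then show "chain_weight k t (w + 1 - k) * lw_count k 0 =
        chain_weight k (Suc t) (w - k) * lw_count k 0 +
        chain_weight k (Suc t) (w - 1 - k) * lw_count k 0"
      by (simp add: distrib_right)
  qed simp
  moreover have "Suc (t + w) choose t = (Suc (t + w) choose Suc w)"
    using binomial_symmetric [of t "Suc (t + w)"] by simp
  ultimately show ?case
    using 3(1) [of "Suc t"] 3(2) [of "Suc t"] lw_tail_Suc [of t "Suc (t + w)"]
    by (simp add: fibF_Suc_Suc add.commute add.left_commute)
qed

lemma chain_weight_0: "chain_weight 0 t m = fibF m"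
  by (induction "0 :: nat" t m rule: chain_weight.induct) (simp_all add: fibF_Suc_Suc)

text \<open>
  Pascal's rule, applied to every coefficient of the series.
\<close>

lemma chain_weight_pascal:
  "chain_weight (Suc k) (Suc t) m = chain_weight k (Suc t) m + chain_weight (Suc k) t m"
  by (induction k t m rule: chain_weight.induct) simp_all

text \<open>
  For \<open>t = 0\<close> the series is \<open>(1 - x - x\<^sup>2) ^ (- (k + 1))\<close>; this is the coefficientwise form of
  \<open>S = R + (x + x\<^sup>2) * S\<close> where \<open>S\<close> belongs to \<open>Suc k\<close> and \<open>R\<close> to \<open>k\<close>.
\<close>

lemma chain_weight_Suc_rec:
  "chain_weight (Suc k) 0 (Suc (Suc m)) =
     chain_weight k 0 (Suc (Suc m)) + chain_weight (Suc k) 0 (Suc m) + chain_weight (Suc k) 0 m"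
  by (simp add: chain_weight_pascal)

text \<open>
  The convolution with the Fibonacci numbers has the same initial values and the same recursion
  \<open>chain_weight_Suc_rec\<close>: two index shifts bring \<open>fibF (i + 2) = fibF (i + 1) + fibF i\<close> into play.
\<close>

lemma chain_weight_Suc:
  "chain_weight (Suc k) 0 m = (\<Sum>i\<le>m. fibF i * chain_weight k 0 (m - i))"
proof (induction m rule: fib.induct)
  case (3 m)
  have "(\<Sum>i\<le>Suc (Suc m). fibF i * chain_weight k 0 (Suc (Suc m) - i)) =
      chain_weight k 0 (Suc (Suc m)) + (chain_weight k 0 (Suc m) +
      (\<Sum>i\<le>m. fibF (Suc (Suc i)) * chain_weight k 0 (m - i)))"
    by (simp only: sum.atMost_Suc_shift) simp
  also have "(\<Sum>i\<le>m. fibF (Suc (Suc i)) * chain_weight k 0 (m - i)) =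
      (\<Sum>i\<le>m. fibF (Suc i) * chain_weight k 0 (m - i)) +
      (\<Sum>i\<le>m. fibF i * chain_weight k 0 (m - i))"
    by (simp add: fibF_Suc_Suc distrib_right sum.distrib)
  also have "chain_weight k 0 (Suc m) + (\<dots>) =
      (\<Sum>i\<le>Suc m. fibF i * chain_weight k 0 (Suc m - i)) +
      (\<Sum>i\<le>m. fibF i * chain_weight k 0 (m - i))"
    by (simp only: sum.atMost_Suc_shift) simp
  finally show ?case using 3 chain_weight_Suc_rec [of k m] by simp
qed simp_all

lemma chain_weight_eq_sum:
  "chain_weight k 0 m = (\<Sum>ns | length ns = Suc k \<and> sum_list ns = m. prod_list (map fibF ns))"
proof (induction k arbitrary: m)
  case 0
  have "{ns :: nat list. length ns = Suc 0 \<and> sum_list ns = m} = {[m]}"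
    by (auto simp: length_Suc_conv)
  then show ?case by (simp add: chain_weight_0)
next
  case (Suc k)
  let ?T = "\<lambda>m. {ns :: nat list. length ns = Suc k \<and> sum_list ns = m}"
  have split: "{ns :: nat list. length ns = Suc (Suc k) \<and> sum_list ns = m} =
      (\<lambda>(i, ns). i # ns) ` (SIGMA i:{..m}. ?T (m - i))"
    by (auto simp: length_Suc_conv image_iff)
  have "(\<Sum>ns | length ns = Suc (Suc k) \<and> sum_list ns = m. prod_list (map fibF ns)) =
      (\<Sum>(i, ns)\<in>(SIGMA i:{..m}. ?T (m - i)). fibF i * prod_list (map fibF ns))"
    unfolding split by (subst sum.reindex) (auto simp: inj_on_def case_prod_beta)
  also have "\<dots> = (\<Sum>i\<le>m. \<Sum>ns\<in>?T (m - i). fibF i * prod_list (map fibF ns))"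
    by (subst sum.Sigma) (auto simp: finite_tuples)
  finally show ?case
    by (simp add: chain_weight_Suc Suc.IH sum_distrib_left)
qed

lemma conv_fib_eq: "k < n \<Longrightarrow> conv_fib (Suc n) k = chain_weight k 0 (n - 1 - k)"
  by (auto simp: conv_fib_def chain_weight_eq_sum intro!: sum.cong)

text \<open>
  Row \<open>n + 1\<close> of the equation \<open>(I - A) X = F\<close>.
\<close>

lemma lw_count_recurrence:
  "lw_count (Suc n) 0 = fibF n + (\<Sum>k<n. conv_fib (Suc n) k * lw_count k 0)"
  using lw_tail_eq [of 0 n] by (simp add: lw_count_Suc_0 conv_fib_eq)

section \<open>Permutations in one-line notation\<close>

text \<open>
  The indexed form, which is the one that compares directly with one-line notation.
\<close>

lemma avoiding_iff_nth:
  "avoiding xs \<longleftrightarrow> (\<forall>i j. i < j \<longrightarrow> Suc j < length xs \<longrightarrow>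
     min (xs ! j) (xs ! Suc j) < xs ! i \<longrightarrow> xs ! i < max (xs ! j) (xs ! Suc j) \<longrightarrow>
     (\<exists>p. i < p \<and> p < j \<and> xs ! p < min (xs ! j) (xs ! Suc j)))"
proof (intro iffI allI impI)
  fix i j
  assume g: "avoiding xs" and ij: "i < j" "Suc j < length xs"
    and x: "min (xs ! j) (xs ! Suc j) < xs ! i" "xs ! i < max (xs ! j) (xs ! Suc j)"
  define vs where "vs = take (j - Suc i) (drop (Suc i) xs)"
  have len: "length vs = j - Suc i" using ij by (simp add: vs_def)
  have vs: "vs ! q = xs ! (Suc i + q)" if "q < j - Suc i" for q
    using that ij by (simp add: vs_def)
  have "xs = take i xs @ xs ! i # drop (Suc i) xs"
    using ij by (intro id_take_nth_drop) simp
  also have "drop (Suc i) xs = vs @ drop (j - Suc i) (drop (Suc i) xs)"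
    by (simp only: vs_def append_take_drop_id)
  also have "drop (j - Suc i) (drop (Suc i) xs) = drop j xs" using ij by simp
  also have "drop j xs = xs ! j # xs ! Suc j # drop (Suc (Suc j)) xs"
    using ij by (simp add: Cons_nth_drop_Suc)
  finally have "\<exists>p\<in>set vs. p < min (xs ! j) (xs ! Suc j)"
    using avoidingD g x by metis
  then obtain q where "q < j - Suc i" "vs ! q < min (xs ! j) (xs ! Suc j)"
    using len by (metis in_set_conv_nth)
  then show "\<exists>p. i < p \<and> p < j \<and> xs ! p < min (xs ! j) (xs ! Suc j)"
    using vs by (intro exI [of _ "Suc i + q"]) auto
next
  assume *: "\<forall>i j. i < j \<longrightarrow> Suc j < length xs \<longrightarrow>
     min (xs ! j) (xs ! Suc j) < xs ! i \<longrightarrow> xs ! i < max (xs ! j) (xs ! Suc j) \<longrightarrow>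
     (\<exists>p. i < p \<and> p < j \<and> xs ! p < min (xs ! j) (xs ! Suc j))"
  show "avoiding xs"
    unfolding avoiding_def
  proof (intro allI impI)
    fix us x vs u v zs
    assume xs: "xs = us @ x # vs @ u # v # zs" and x: "min u v < x" "x < max u v"
    define i j where "i = length us" and "j = Suc (length us + length vs)"
    have nth: "xs ! i = x" "xs ! j = u" "xs ! Suc j = v" "i < j" "Suc j < length xs"
      by (simp_all add: xs i_def j_def nth_append)
    with * x obtain p where p: "i < p" "p < j" "xs ! p < min u v" by metis
    then have "xs ! p = vs ! (p - Suc i)" "p - Suc i < length vs"
      by (auto simp: xs i_def j_def nth_append nth_Cons')
    with p(3) show "\<exists>p\<in>set vs. p < min u v" by auto
  qed
qed

lemma avoiding_one_line_iff:
  "avoiding (map s [1..<Suc n]) \<longleftrightarrow> avoids_3_bar1_42 n s \<and> avoids_3_bar1_24 n s"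
proof -
  have shift: "(\<forall>i j. 1 \<le> i \<and> i < j \<and> j + 1 \<le> n \<longrightarrow> P i j) \<longleftrightarrow>
      (\<forall>i j. i < j \<longrightarrow> Suc j < n \<longrightarrow> P (Suc i) (Suc j))" for P
  proof (intro iffI allI impI)
    fix i j
    assume *: "\<forall>i j. i < j \<longrightarrow> Suc j < n \<longrightarrow> P (Suc i) (Suc j)"
      and ij: "1 \<le> i \<and> i < j \<and> j + 1 \<le> n"
    then have "i - 1 < j - 1" "Suc (j - 1) < n" by auto
    with * have "P (Suc (i - 1)) (Suc (j - 1))" by blast
    with ij show "P i j" by simp
  qed auto
  have shift_ex: "(\<exists>p. Suc i < p \<and> p < Suc j \<and> Q p) \<longleftrightarrow> (\<exists>p. i < p \<and> p < j \<and> Q (Suc p))"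
    for i j Q
    by (metis Suc_less_eq Suc_less_eq2)
  have nth: "map s [1..<Suc n] ! i = s (Suc i)" if "i < n" for i
    using that by (simp del: upt_Suc)
  have "avoids_3_bar1_42 n s \<and> avoids_3_bar1_24 n s \<longleftrightarrow>
    (\<forall>i j. 1 \<le> i \<and> i < j \<and> j + 1 \<le> n \<longrightarrow>
      min (s j) (s (j + 1)) < s i \<longrightarrow> s i < max (s j) (s (j + 1)) \<longrightarrow>
      (\<exists>p. i < p \<and> p < j \<and> s p < min (s j) (s (j + 1))))"
    unfolding avoids_3_bar1_42_def avoids_3_bar1_24_def
    by (auto simp: min_def max_def)
  also have "\<dots> \<longleftrightarrow> (\<forall>i j. i < j \<longrightarrow> Suc j < n \<longrightarrow>
      min (s (Suc j)) (s (Suc j + 1)) < s (Suc i) \<longrightarrow>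
      s (Suc i) < max (s (Suc j)) (s (Suc j + 1)) \<longrightarrow>
      (\<exists>p. Suc i < p \<and> p < Suc j \<and> s p < min (s (Suc j)) (s (Suc j + 1))))"
    by (rule shift)
  also have "\<dots> \<longleftrightarrow> avoiding (map s [1..<Suc n])"
    unfolding avoiding_iff_nth shift_ex
    by (intro arg_cong [of _ _ All] ext imp_cong refl)
      (auto simp: nth simp del: upt_Suc)
  finally show ?thesis by simp
qed

lemma num_avoiders_eq: "num_avoiders n = lw_count n 0"
proof -
  let ?w = "\<lambda>s :: nat \<Rightarrow> nat. map s [1..<Suc n]"
  let ?G = "{z \<in> permutations_of_set {1..n}. avoiding z}"
  have set: "set [1..<Suc n] = {1..n}" by auto
  have "bij_betw ?w (avoiders n) ?G"
  proof (rule bij_betw_imageI)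
    show "inj_on ?w (avoiders n)"
    proof (rule inj_onI, rule ext)
      fix s s' x
      assume s: "s \<in> avoiders n" "s' \<in> avoiders n" and eq: "?w s = ?w s'"
      show "s x = s' x"
      proof (cases "x \<in> {1..n}")
        case True
        then have "x \<in> set [1..<Suc n]" unfolding set .
        then show ?thesis using eq map_eq_conv [of s "[1..<Suc n]" s'] by blast
      next
        case False
        with s have "s x = x" "s' x = x"
          by (simp_all add: avoiders_def permutes_def del: atLeastAtMost_iff)
        then show ?thesis by simp
      qed
    qed
    show "?w ` avoiders n = ?G"
    proof (intro equalityI subsetI)
      fix z assume "z \<in> ?w ` avoiders n"
      then obtain s where s: "s permutes {1..n}" "avoiding z" "z = ?w s"
        using avoiding_one_line_iff by (auto simp: avoiders_def simp del: upt_Suc)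
      then have "set z = {1..n}"
        by (simp only: list.set_map set permutes_image)
      moreover have "distinct z"
        using permutes_inj_on [OF s(1)] s(3) by (simp only: distinct_map distinct_upt)
      ultimately show "z \<in> ?G" using s(2) by (simp add: permutations_of_set_def)
    next
      fix z assume z: "z \<in> ?G"
      then have z': "distinct z" "set z = {1..n}" "length z = n" "avoiding z"
        using length_finite_permutations_of_set [of z "{1..n}"]
        by (auto simp: permutations_of_set_def)
      define s where "s i = (if i \<in> {1..n} then z ! (i - 1) else i)" for i
      have ws: "?w s = z"
        by (rule nth_equalityI) (use z' in \<open>auto simp: s_def simp del: upt_Suc\<close>)
      then have "s ` {1..n} = {1..n}" using z' set by (metis list.set_map)
      then have "bij_betw s {1..n} {1..n}"
        by (simp add: bij_betw_def eq_card_imp_inj_on)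
      then have "s permutes {1..n}"
        by (rule bij_imp_permutes) (auto simp: s_def)
      with ws z' avoiding_one_line_iff [of s n] have "s \<in> avoiders n"
        by (simp add: avoiders_def del: upt_Suc)
      with ws show "z \<in> ?w ` avoiders n" by blast
    qed
  qed
  then have "num_avoiders n = card ?G"
    unfolding num_avoiders_def by (rule bij_betw_same_card)
  also have "\<dots> = card (linked_words {1..n} 0)"
    by (simp add: linked_words_0 card_cartesian_product)
  also have "\<dots> = lw_count n 0"
    by (simp add: card_linked_words)
  finally show ?thesis .
qed

section \<open>The matrix identity\<close>

lemma id_minus_A_apply_X: "lt_apply (id_mat - A_mat) X_vec = F_vec"
proof
  fix n
  have "lt_apply (id_mat - A_mat) X_vec n =
      (\<Sum>j\<le>n. id_mat n j * X_vec j) - (\<Sum>j\<le>n. A_mat n j * X_vec j)"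
    by (simp add: lt_apply_def left_diff_distrib sum_subtractf)
  also have "(\<Sum>j\<le>n. id_mat n j * X_vec j) = X_vec n"
    by (simp add: id_mat_def if_distrib [of "\<lambda>x. x * _"] cong: if_cong)
  also have "X_vec n - (\<Sum>j\<le>n. A_mat n j * X_vec j) = F_vec n"
  proof (cases n)
    case 0
    then show ?thesis by (simp add: A_mat_strict X_vec_def F_vec_def num_avoiders_0)
  next
    case (Suc m)
    have "(\<Sum>j\<le>n. A_mat n j * X_vec j) = (\<Sum>j<m. A_mat n j * X_vec j)"
      by (rule sum.mono_neutral_right) (auto simp: Suc A_mat_def conv_fib_def)
    then show ?thesis
      by (simp add: Suc X_vec_def F_vec_def A_mat_def num_avoiders_eq lw_count_recurrence)
  qed
  finally show "lt_apply (id_mat - A_mat) X_vec n = F_vec n" .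
qed

text \<open>
  A vector is treated as a matrix all of whose columns are equal to it, so that associativity of
  the matrix product applies.
\<close>

lemma lt_apply_assoc:
  assumes "lower_triangular N"
  shows "lt_apply (lt_mult M N) v = lt_apply M (lt_apply N v)"
  using fun_cong [OF fun_cong [OF lt_mult_assoc [OF assms, of M "\<lambda>j k. v j"]]]
  by (auto simp: lt_apply_def lt_mult_def)

theorem theorem3p10:
  shows "X_vec = lt_apply (lt_inverse (id_mat - A_mat)) F_vec"
proof -
  let ?B = "lt_inverse (id_mat - A_mat)"
  have "lt_apply ?B F_vec = lt_apply (lt_mult ?B (id_mat - A_mat)) X_vec"
    by (simp add: lt_apply_assoc [OF lower_triangular_id_minus_A] id_minus_A_apply_X)
  also have "\<dots> = lt_apply id_mat X_vec"
    using is_lt_inverse_lt_inverse by (simp add: is_lt_inverse_def)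
  also have "\<dots> = X_vec"
    by (simp add: fun_eq_iff lt_apply_def id_mat_def if_distrib [of "\<lambda>x. x * _"] cong: if_cong)
  finally show ?thesis by simp
qed

end
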